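(* A simple permutation has at most $48$ pin words, and all of them are strict or quasi-strict.
   Context: A permutation of size $n$ is simple if $n\ge4$ and its only blocks (sets of consecutive positions whose images form an interval) are singletons and $\{1,\dots,n\}$. A pin representation of a permutation is a sequence of points $(p_1,\dots,p_n)$, no two on a common horizontal or vertical line, order-isomorphic to its diagram $\{(i,\pi_i)\}$, such that each $p_i$ ($i\ge2$) lies outside the bounding box (smallest axis-parallel rectangle) of $\{p_1,\dots,p_{i-1}\}$ and either separates $p_{i-1}$ from $\{p_1,\dots,p_{i-2}\}$ (the horizontal or vertical line through $p_i$ has them on opposite sides) or does not separate $\{p_1,\dots,p_{i-1}\}$ into two nonempty sets. Pin words: given a pin representation and an origin point $p_0$ such that $(p_0,p_1,\dots,p_n)$ satisfies the same conditions, each $p_i$ ($i\ge1$) is encoded by $U$ (resp. $D,L,R$) if $p_i$ separates $p_{i-1}$ from $\{p_0,\dots,p_{i-2}\}$ from the top (resp. bottom, left, right), and by $1$ (resp. $2,3,4$) if $p_i$ does not separate $\{p_0,\dots,p_{i-1}\}$ into two nonempty sets and lies up-right (resp. up-left, bottom-left, bottom-right) of the bounding box of $\{p_0,\dots,p_{i-1}\}$; the pin words of a permutation are all words so obtained from all its pin representations and admissible origins. A strict (resp. quasi-strict) pin word consists of one numeral (resp. two numerals) among $1,2,3,4$ followed only by letters of $\{U,D,L,R\}$. *)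

theory Defs
  imports Complex_Main "HOL-Combinatorics.Permutations"
begin

definition block :: "nat \<Rightarrow> (nat \<Rightarrow> nat) \<Rightarrow> nat set \<Rightarrow> bool" where
  "block n \<pi> I \<longleftrightarrow>
     (\<exists>i j. 1 \<le> i \<and> i \<le> j \<and> j \<le> n \<and> I = {i..j}) \<and> (\<exists>a b. \<pi> ` I = {a..b})"

definition simple_permutation :: "nat \<Rightarrow> (nat \<Rightarrow> nat) \<Rightarrow> bool" where
  "simple_permutation n \<pi> \<longleftrightarrow>
     \<pi> permutes {1..n} \<and> n \<ge> 4 \<and> (\<forall>I. block n \<pi> I \<longrightarrow> (\<exists>i. I = {i}) \<or> I = {1..n})"

type_synonym point = "real \<times> real"

definition diagram :: "nat \<Rightarrow> (nat \<Rightarrow> nat) \<Rightarrow> point set" where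
  "diagram n \<pi> = (\<lambda>i. (real i, real (\<pi> i))) ` {1..n}"

definition order_isomorphic :: "point set \<Rightarrow> point set \<Rightarrow> bool" where
  "order_isomorphic A B \<longleftrightarrow>
     (\<exists>f. bij_betw f A B \<and>
        (\<forall>p\<in>A. \<forall>q\<in>A. (fst p < fst q \<longleftrightarrow> fst (f p) < fst (f q)) \<and>
                        (snd p < snd q \<longleftrightarrow> snd (f p) < snd (f q))))"

text \<open>Only meaningful for finite nonempty sets of points.\<close>

definition bounding_box :: "point set \<Rightarrow> point set" where
  "bounding_box A = {Min (fst ` A)..Max (fst ` A)} \<times> {Min (snd ` A)..Max (snd ` A)}"

text \<open>Some axis-parallel line through \<open>p\<close> has \<open>A\<close> and \<open>B\<close> strictly on opposite sides.
  Both sets are required to be nonempty, so nothing is separated from the empty set; in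
  particular the first point after the origin is never encoded by a direction.\<close>

definition separates :: "point \<Rightarrow> point set \<Rightarrow> point set \<Rightarrow> bool" where
  "separates p A B \<longleftrightarrow> A \<noteq> {} \<and> B \<noteq> {} \<and>
     ((\<forall>a\<in>A. \<forall>b\<in>B. fst a < fst p \<and> fst p < fst b) \<or>
      (\<forall>a\<in>A. \<forall>b\<in>B. fst b < fst p \<and> fst p < fst a) \<or>
      (\<forall>a\<in>A. \<forall>b\<in>B. snd a < snd p \<and> snd p < snd b) \<or>
      (\<forall>a\<in>A. \<forall>b\<in>B. snd b < snd p \<and> snd p < snd a))"

definition splits :: "point \<Rightarrow> point set \<Rightarrow> bool" where
  "splits p S \<longleftrightarrow> (\<exists>A B. A \<union> B = S \<and> separates p A B)"

text \<open>The conditions on the sequence \<open>p m, \<dots>, p n\<close>. They are used with \<open>m = 1\<close> for pin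
  representations, and with \<open>m = 0\<close> when the origin \<open>p 0\<close> is included.\<close>

definition pin_sequence :: "nat \<Rightarrow> nat \<Rightarrow> (nat \<Rightarrow> point) \<Rightarrow> bool" where
  "pin_sequence m n p \<longleftrightarrow>
     (\<forall>i\<in>{m..n}. \<forall>j\<in>{m..n}. i \<noteq> j \<longrightarrow> fst (p i) \<noteq> fst (p j) \<and> snd (p i) \<noteq> snd (p j)) \<and>
     (\<forall>i\<in>{m<..n}. p i \<notin> bounding_box (p ` {m..<i}) \<and>
        (separates (p i) {p (i - 1)} (p ` {m..<i - 1}) \<or> \<not> splits (p i) (p ` {m..<i})))"

definition pin_representation :: "nat \<Rightarrow> (nat \<Rightarrow> nat) \<Rightarrow> (nat \<Rightarrow> point) \<Rightarrow> bool" where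
  "pin_representation n \<pi> p \<longleftrightarrow>
     pin_sequence 1 n p \<and> order_isomorphic (p ` {1..n}) (diagram n \<pi>)"

datatype pin_letter = N1 | N2 | N3 | N4 | U | D | L | R

definition numerals :: "pin_letter set" where
  "numerals = {N1, N2, N3, N4}"

definition directions :: "pin_letter set" where
  "directions = {U, D, L, R}"

definition above :: "point \<Rightarrow> point set \<Rightarrow> bool" where
  "above p S \<longleftrightarrow> (\<forall>q\<in>S. snd q < snd p)"

definition below :: "point \<Rightarrow> point set \<Rightarrow> bool" where
  "below p S \<longleftrightarrow> (\<forall>q\<in>S. snd p < snd q)"

definition left_of :: "point \<Rightarrow> point set \<Rightarrow> bool" where
  "left_of p S \<longleftrightarrow> (\<forall>q\<in>S. fst p < fst q)"

definition right_of :: "point \<Rightarrow> point set \<Rightarrow> bool" where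
  "right_of p S \<longleftrightarrow> (\<forall>q\<in>S. fst q < fst p)"

fun in_position :: "pin_letter \<Rightarrow> point \<Rightarrow> point set \<Rightarrow> bool" where
  "in_position U p S = above p S"
| "in_position D p S = below p S"
| "in_position L p S = left_of p S"
| "in_position R p S = right_of p S"
| "in_position N1 p S = (above p S \<and> right_of p S)"
| "in_position N2 p S = (above p S \<and> left_of p S)"
| "in_position N3 p S = (below p S \<and> left_of p S)"
| "in_position N4 p S = (below p S \<and> right_of p S)"

definition encodes :: "(nat \<Rightarrow> point) \<Rightarrow> nat \<Rightarrow> pin_letter \<Rightarrow> bool" where
  "encodes p i c \<longleftrightarrow>
     in_position c (p i) (bounding_box (p ` {0..<i})) \<and>
     (if c \<in> directions then separates (p i) {p (i - 1)} (p ` {0..<i - 1})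
      else \<not> splits (p i) (p ` {0..<i}))"

text \<open>The letter at list index \<open>i\<close> encodes the point \<open>p (i + 1)\<close>.\<close>

definition pin_words :: "nat \<Rightarrow> (nat \<Rightarrow> nat) \<Rightarrow> pin_letter list set" where
  "pin_words n \<pi> =
     {w. length w = n \<and>
         (\<exists>p. pin_representation n \<pi> p \<and> pin_sequence 0 n p \<and>
              (\<forall>i<n. encodes p (Suc i) (w ! i)))}"

definition strict_pin_word :: "pin_letter list \<Rightarrow> bool" where
  "strict_pin_word w \<longleftrightarrow>
     (\<exists>a v. w = a # v \<and> a \<in> numerals \<and> set v \<subseteq> directions)"

definition quasi_strict_pin_word :: "pin_letter list \<Rightarrow> bool" where
  "quasi_strict_pin_word w \<longleftrightarrow>
     (\<exists>a b v. w = a # b # v \<and> a \<in> numerals \<and> b \<in> numerals \<and> set v \<subseteq> directions)"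

end

(* A pin order of a simple permutation is determined by its first two points: among the points
   outside p_1, ..., p_k only p_(k+1) cuts their bounding box. A pair of starting points therefore
   generates a chain of sets, each having exactly one cutting point. Fix one pin order p_1, ..., p_n
   and classify the other starting pairs {p_i, p_j} with i < j by j. Besides {p_1, p_2} there is at
   most one with j = 3 and at most two with j = n (p_n is extremal in one direction, and of three
   partners the outermost one would give two cutting points). A pair with 4 <= j < n is cut by
   p_(j+1) only, so p_i is a corner of p_1, ..., p_(j-2); this forces n = j + 1 <= 6, and then there
   is only one such pair, and only one with j = n. Hence there are at most 4 starting pairs, so 8
   ordered ones, and for each of them the possible origins give at most 6 choices for the first
   two letters, which determine the word. If some p_i with i >= 3 were encoded by a numeral, then
   p_1, ..., p_(i-1) would form a nontrivial block. *)
theory Submission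
  imports Defs
begin

section \<open>Starting pairs of pin orders\<close>

definition btw :: "real \<Rightarrow> real \<Rightarrow> real \<Rightarrow> bool" where
  "btw a b c \<longleftrightarrow> a < b \<and> b < c \<or> c < b \<and> b < a"

text \<open>The index \<open>m\<close> is 0 if the origin counts and 1 otherwise. For
  \<open>l - 1 \<le> m\<close> the condition is vacuous, whereas \<open>separates\<close> fails on
  an empty set.\<close>

definition separating :: "nat \<Rightarrow> (nat \<Rightarrow> real) \<Rightarrow> nat \<Rightarrow> bool" where
  "separating m x l \<longleftrightarrow> (\<forall>k\<in>{m..<l - 1}. btw (x k) (x l) (x (l - 1)))"

definition extremal :: "nat \<Rightarrow> (nat \<Rightarrow> real) \<Rightarrow> nat \<Rightarrow> bool" where
  "extremal m x l \<longleftrightarrow> (\<forall>k\<in>{m..<l}. x k < x l) \<or> (\<forall>k\<in>{m..<l}. x l < x k)"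

text \<open>The points \<open>(x l, y l)\<close> form a pin sequence none of whose points beyond the second lies in a
  corner position, as in every pin representation of a simple permutation.\<close>

definition pin_coords :: "nat \<Rightarrow> (nat \<Rightarrow> real) \<Rightarrow> (nat \<Rightarrow> real) \<Rightarrow> bool" where
  "pin_coords n x y \<longleftrightarrow> inj_on x {1..n} \<and> inj_on y {1..n} \<and>
     (\<forall>l\<in>{3..n}. separating 1 x l \<and> extremal 1 y l \<or> separating 1 y l \<and> extremal 1 x l)"

definition cuts :: "(nat \<Rightarrow> real) \<Rightarrow> (nat \<Rightarrow> real) \<Rightarrow> nat set \<Rightarrow> nat \<Rightarrow> bool" where
  "cuts x y S k \<longleftrightarrow>
     k \<notin> S \<and> (\<exists>a\<in>S. \<exists>b\<in>S. btw (x a) (x k) (x b) \<or> btw (y a) (y k) (y b))"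

text \<open>The chain of sets with a unique cutting point; \<open>C\<close> is to be instantiated by \<open>cuts x y\<close>, and
  \<open>n\<close> bounds the labels of the points.\<close>

inductive grows :: "nat \<Rightarrow> (nat set \<Rightarrow> nat \<Rightarrow> bool) \<Rightarrow> nat set \<Rightarrow> bool"
  for n C where
  full: "grows n C {1..n}"
| step: "\<lbrakk>m \<in> {1..n}; C S m; \<And>k. k \<in> {1..n} \<Longrightarrow> C S k \<Longrightarrow> k = m; grows n C (insert m S)\<rbrakk>
    \<Longrightarrow> grows n C S"

section \<open>Symmetries, and sets with a unique cutting point\<close>

lemma btw_neg [simp]: "btw (- a) (- b) (- c) = btw a b c"
  by (auto simp: btw_def)

text \<open>These symmetries, with the analogous rules for \<open>pin_coords\<close>, let
  \<open>grows_rigid\<close> reduce the eight orientations of a pin to a single one.\<close>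

lemma cuts_neg1: "cuts (\<lambda>i. - x i) y = cuts x y"
  and cuts_neg2: "cuts x (\<lambda>i. - y i) = cuts x y"
  and cuts_swap: "cuts y x = cuts x y"
  by (simp_all add: cuts_def fun_eq_iff disj_commute)

lemma extremal_neg [simp]: "extremal m (\<lambda>i. - x i) l = extremal m x l"
  by (auto simp: extremal_def)

lemma separating_neg [simp]: "separating m (\<lambda>i. - x i) l = separating m x l"
  by (auto simp: separating_def)

lemma pin_coords_neg1: "pin_coords n (\<lambda>i. - x i) y = pin_coords n x y"
  and pin_coords_neg2: "pin_coords n x (\<lambda>i. - y i) = pin_coords n x y"
  and pin_coords_swap: "pin_coords n y x = pin_coords n x y"
  by (simp add: pin_coords_def inj_on_def, simp add: pin_coords_def inj_on_def, unfold pin_coords_def, blast)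

lemma pin_coordsD:
  assumes "pin_coords n x y" "3 \<le> l" "l \<le> n"
  shows "separating 1 x l \<and> extremal 1 y l \<or> separating 1 y l \<and> extremal 1 x l"
  using assms by (auto simp: pin_coords_def)

lemma cutsI1: "a \<in> S \<Longrightarrow> b \<in> S \<Longrightarrow> k \<notin> S \<Longrightarrow> btw (x a) (x k) (x b) \<Longrightarrow> cuts x y S k"
  and cutsI2: "a \<in> S \<Longrightarrow> b \<in> S \<Longrightarrow> k \<notin> S \<Longrightarrow> btw (y a) (y k) (y b) \<Longrightarrow> cuts x y S k"
  by (auto simp: cuts_def)

lemma not_cuts_full: "k \<in> {1..n} \<Longrightarrow> \<not> cuts x y {1..n} k"
  by (simp add: cuts_def)

lemma grows_unique:
  assumes "grows n (cuts x y) S" "cuts x y S k" "k \<in> {1..n}" "cuts x y S l" "l \<in> {1..n}"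
  shows "l = k"
  using assms(1)
proof cases
  case full
  then show ?thesis using assms not_cuts_full by blast
next
  case (step m)
  then show ?thesis using assms by blast
qed

text \<open>The rule \<open>step\<close> adds the only cutting point, so any cutting point that can
  be exhibited is the one added. This follows a chain forwards from a pair.\<close>

lemma grows_insert:
  assumes "grows n (cuts x y) S" "cuts x y S k" "k \<in> {1..n}"
  shows "grows n (cuts x y) (insert k S)"
  using assms(1)
proof cases
  case full
  then show ?thesis using assms not_cuts_full by blast
next
  case (step m)
  then show ?thesis using assms by blast
qed

lemma grows_stuck:
  assumes "grows n C S" "\<And>k. k \<in> {1..n} \<Longrightarrow> \<not> C S k"
  shows "S = {1..n}"
  using assms(1)
proof cases
  case (step m)
  then show ?thesis using assms(2) by blast
qed

section \<open>The next pin as a cutting point, and pairs {i, j} with 4 <= j < n\<close>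

lemma pin_coords_next_btw:
  assumes "pin_coords n x y" "1 \<le> i" "i < j" "j < n"
  shows "btw (x i) (x (j+1)) (x j) \<or> btw (y i) (y (j+1)) (y j)"
proof -
  have "j + 1 \<in> {3..n}" "i \<in> {1..<j + 1 - 1}" using assms by auto
  then show ?thesis using assms(1) unfolding pin_coords_def separating_def by fastforce
qed

text \<open>If \<open>{i, j}\<close> starts a chain, \<open>j + 1\<close> is thus its only cutting
  point, and no point before \<open>j\<close> may lie between \<open>i\<close> and \<open>j\<close>
  in either coordinate.\<close>

lemma pin_coords_next_cuts:
  assumes "pin_coords n x y" "1 \<le> i" "i < j" "j < n" "i \<in> S" "j \<in> S" "j + 1 \<notin> S"
  shows "cuts x y S (j+1)"
  using pin_coords_next_btw[OF assms(1-4)] assms(5-7) unfolding cuts_def by blast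

text \<open>What is left of a starting pair \<open>{i, j}\<close> with \<open>4 \<le> j < n\<close>; it occurs only for \<open>n = 5\<close> and \<open>n = 6\<close>.\<close>

definition rigid :: "nat \<Rightarrow> (nat \<Rightarrow> real) \<Rightarrow> (nat \<Rightarrow> real) \<Rightarrow> nat \<Rightarrow> nat \<Rightarrow> bool" where
  "rigid n x y i j \<longleftrightarrow> n = j + 1 \<and>
     (\<forall>i'\<in>{1..<j}. grows n (cuts x y) {i', j} \<longrightarrow> i' = i) \<and>
     (\<forall>k\<in>{1..<n}. \<forall>k'\<in>{1..<n}. grows n (cuts x y) {k, n} \<longrightarrow> grows n (cuts x y) {k', n} \<longrightarrow> k = k')"

text \<open>Here p_j comes from the right and passes below p_(j-1) only. As p_(j+1) alone cuts the
  pair, p_i is the rightmost point before p_j and, unless i = j - 1, the highest of the first j - 2.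
  But p_(j-1) is the highest point so far, hence separates by its column and is not rightmost, so i
  < j - 1. A pin of index at least 3 lies between two earlier ones in some coordinate and cannot be
  such a corner, which leaves 1 and 2.\<close>

lemma grows_corner:
  assumes pin: "pin_coords n x y" and g: "grows n (cuts x y) {i, j}"
    and ij: "1 \<le> i" "i < j" "4 \<le> j" "j < n"
    and right: "\<forall>k\<in>{1..<j}. x k < x j"
    and up: "\<forall>k\<in>{1..<j-1}. y k < y j \<and> y j < y (j-1)"
  shows "i \<in> {1, 2}" "\<forall>k\<in>{1..<j}. k \<noteq> i \<longrightarrow> x k < x i"
    "\<forall>k\<in>{1..<j-1}. k \<noteq> i \<longrightarrow> y k < y i" "separating 1 x (j - 1)"
proof -
  have c: "cuts x y {i, j} (j+1)"
    by (rule pin_coords_next_cuts[of n x y i j]) (use pin ij in auto)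
  have nc: "\<not> cuts x y {i, j} k" if "k \<in> {1..<j}" for k
    using grows_unique[OF g c, of k] that ij by auto
  have xi: "x k \<le> x i" if "k \<in> {1..<j}" "k \<noteq> i" for k
  proof (rule ccontr)
    assume "\<not> x k \<le> x i"
    then have "btw (x i) (x k) (x j)" using right that(1) by (auto simp: btw_def)
    then have "cuts x y {i, j} k" using that by (intro cutsI1[of i _ j]) auto
    then show False using nc[OF that(1)] by blast
  qed
  have yi: "y k \<le> y i" if "k \<in> {1..<j-1}" "k \<noteq> i" "i < j - 1" for k
  proof (rule ccontr)
    assume "\<not> y k \<le> y i"
    then have "btw (y i) (y k) (y j)" using up that(1) by (auto simp: btw_def)
    then have "cuts x y {i, j} k" using that by (intro cutsI2[of i _ j]) auto
    moreover have "k \<in> {1..<j}" using that(1) by auto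
    ultimately show False using nc by blast
  qed
  have "\<not> separating 1 y (j - 1)"
  proof -
    have "y k < y (j - 1)" if "k \<in> {1..<j-1}" for k
      using up that by (meson less_trans)
    moreover have "1 \<in> {1..<j-1}" "j - 1 - 1 \<in> {1..<j-1}" using ij by auto
    ultimately have "y 1 < y (j - 1)" "y (j - 1 - 1) < y (j - 1)" by blast+
    then have "\<not> btw (y 1) (y (j - 1)) (y (j - 1 - 1))" by (auto simp: btw_def)
    moreover have "1 \<in> {1..<j - 1 - 1}" using ij by auto
    ultimately show ?thesis unfolding separating_def by blast
  qed
  then show s: "separating 1 x (j - 1)"
    using pin_coordsD[OF pin, of "j - 1"] ij by linarith
  moreover have "1 \<in> {1..<j - 1 - 1}" using ij by auto
  ultimately have b: "btw (x 1) (x (j - 1)) (x (j - 1 - 1))"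
    using s unfolding separating_def by blast
  have "i \<noteq> j - 1"
  proof
    assume *: "i = j - 1"
    then have "x 1 \<le> x i" "x (i - 1) \<le> x i"
    proof -
      have "1 \<in> {1..<j}" "i - 1 \<in> {1..<j}" "1 \<noteq> i" "i - 1 \<noteq> i"
        using * ij by auto
      then show "x 1 \<le> x i" "x (i - 1) \<le> x i"
        using xi by blast+
    qed
    with b show False unfolding btw_def * by auto
  qed
  then have i: "i < j - 1" using ij by auto
  show "i \<in> {1, 2}"
  proof (rule ccontr)
    assume "i \<notin> {1, 2}"
    then have i3: "3 \<le> i" using ij by auto
    then have "separating 1 x i \<or> separating 1 y i"
      using pin_coordsD[OF pin, of i] ij by linarith
    moreover have "1 \<in> {1..<i - 1}" using i3 by auto
    ultimately have b: "btw (x 1) (x i) (x (i - 1)) \<or> btw (y 1) (y i) (y (i - 1))"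
      unfolding separating_def by blast
    have "x 1 \<le> x i" "x (i - 1) \<le> x i" "y 1 \<le> y i" "y (i - 1) \<le> y i"
    proof -
      have "1 \<in> {1..<j}" "i - 1 \<in> {1..<j}" "1 \<in> {1..<j-1}" "i - 1 \<in> {1..<j-1}" "1 \<noteq> i" "i - 1 \<noteq> i"
        using i i3 by auto
      then show "x 1 \<le> x i" "x (i - 1) \<le> x i" "y 1 \<le> y i" "y (i - 1) \<le> y i"
        using xi yi i by blast+
    qed
    then show False using b unfolding btw_def by linarith
  qed
  have inj: "inj_on x {1..n}" "inj_on y {1..n}" using pin by (auto simp: pin_coords_def)
  have ne: "x k \<noteq> x i \<and> y k \<noteq> y i" if "k \<in> {1..<j}" "k \<noteq> i" for k
  proof -
    have "k \<in> {1..n}" "i \<in> {1..n}" using that ij by auto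
    then show ?thesis using inj that(2) by (simp add: inj_on_eq_iff)
  qed
  show "\<forall>k\<in>{1..<j}. k \<noteq> i \<longrightarrow> x k < x i"
  proof (intro ballI impI)
    fix k assume "k \<in> {1..<j}" "k \<noteq> i"
    with xi[of k] ne[of k] show "x k < x i" by auto
  qed
  show "\<forall>k\<in>{1..<j-1}. k \<noteq> i \<longrightarrow> y k < y i"
  proof (intro ballI impI)
    fix k assume k: "k \<in> {1..<j-1}" "k \<noteq> i"
    then have "k \<in> {1..<j}" by auto
    with yi[OF k i] ne[of k] k(2) show "y k < y i" by force
  qed
qed

lemma two_cuts_not_grows:
  assumes "cuts x y S k" "cuts x y S l" "k \<noteq> l" "k \<in> {1..n}" "l \<in> {1..n}"
  shows "\<not> grows n (cuts x y) S"
  using assms grows_unique by blast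

lemma two_cutsI:
  assumes "k \<noteq> l" "k \<in> {1..n}" "l \<in> {1..n}" "k \<noteq> a" "k \<noteq> b" "l \<noteq> a" "l \<noteq> b"
    "btw (x a) (x k) (x b) \<or> btw (y a) (y k) (y b)"
    "btw (x a) (x l) (x b) \<or> btw (y a) (y l) (y b)"
  shows "\<not> grows n (cuts x y) {a, b}"
  by (rule two_cuts_not_grows[of _ _ _ k l]) (use assms in \<open>auto simp: cuts_def\<close>)

text \<open>The pin p_(j+1) must separate by its column, and the next cutting point of the chain
  must be unique too. If p_(j+1) is on top, p_(j-1) cuts next, which leads to j = 5 and n = 6. If it
  is at the bottom, every point before p_(j-1) other than p_i cuts, which leads to j = 4 and n =
  5.\<close>

lemma grows_rigid_oriented:
  assumes pin: "pin_coords n x y" and g: "grows n (cuts x y) {i, j}"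
    and ij: "1 \<le> i" "i < j" "4 \<le> j" "j < n"
    and right: "\<forall>k\<in>{1..<j}. x k < x j"
    and up: "\<forall>k\<in>{1..<j-1}. y k < y j \<and> y j < y (j-1)"
  shows "rigid n x y i j"
proof -
  note corner = grows_corner[OF pin _ _ _ ij(3,4) right up]
  have i: "i = 1 \<or> i = 2" using corner(1)[OF g ij(1,2)] by auto
  have xi: "x k < x i" if "1 \<le> k" "k < j" "k \<noteq> i" for k
    using corner(2)[OF g ij(1,2)] that by auto
  have yi: "y k < y i" if "1 \<le> k" "k < j - 1" "k \<noteq> i" for k
    using corner(3)[OF g ij(1,2)] that by auto
  have s: "btw (x k) (x (j - 1)) (x (j - 2))" if "1 \<le> k" "k < j - 2" for k
    using corner(4)[OF g ij(1,2)] that by (auto simp: separating_def numeral_2_eq_2)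
  have uniq: "\<forall>i'\<in>{1..<j}. grows n (cuts x y) {i', j} \<longrightarrow> i' = i"
  proof (intro ballI impI, rule ccontr)
    fix i' assume i': "i' \<in> {1..<j}" "grows n (cuts x y) {i', j}" "i' \<noteq> i"
    have "x i < x i'" using corner(2)[OF i'(2)] i' ij by auto
    moreover have "x i' < x i" using xi i' by auto
    ultimately show False by simp
  qed
  \<comment> \<open>\<open>b\<close> is the other one of the first two points.\<close>
  define b where "b = 3 - i"
  have b: "b \<noteq> i" "1 \<le> b" "b < 3" using i by (auto simp: b_def)
  have j1: "y 1 < y j" "y j < y (j - 1)" using up[rule_format, of 1] ij by auto
  have up': "y k < y j" if "1 \<le> k" "k < j - 1" for k using up that by auto
  \<comment> \<open>The row of p_j lies between those of p_1 and p_(j-1), so no row has p_j on one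
    side and both of these on the other.\<close>
  have "\<not> separating 1 y (j + 1)"
  proof
    assume "separating 1 y (j + 1)"
    then have "btw (y k) (y (j + 1)) (y j)" if "k \<in> {1..<j}" for k
      using that by (auto simp: separating_def)
    moreover have "1 \<in> {1..<j}" "j - 1 \<in> {1..<j}" using ij by auto
    ultimately have "btw (y 1) (y (j + 1)) (y j)" "btw (y (j - 1)) (y (j + 1)) (y j)" by blast+
    then show False using j1 by (auto simp: btw_def)
  qed
  then have sx: "separating 1 x (j + 1)" and ey: "extremal 1 y (j + 1)"
    using pin_coordsD[OF pin, of "j + 1"] ij by auto
  have x1: "x k < x (j + 1)" "x (j + 1) < x j" if "1 \<le> k" "k < j" for k
  proof -
    have "btw (x k) (x (j + 1)) (x j)" using sx that by (auto simp: separating_def)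
    moreover have "x k < x j" using right that by auto
    ultimately show "x k < x (j + 1)" "x (j + 1) < x j" by (auto simp: btw_def)
  qed
  have g3: "grows n (cuts x y) {j + 1, i, j}"
  proof (rule grows_insert[OF g])
    show "cuts x y {i, j} (j + 1)"
      by (rule pin_coords_next_cuts[of n x y i j]) (use pin ij in auto)
  qed (use ij in auto)
  have next3: "cuts x y {j + 1, i, j} (j + 2)" if "j + 2 \<le> n"
    using pin_coords_next_cuts[of n x y i "j + 1" "{j + 1, i, j}"] pin ij that by auto
  have uniq3: "k = l" if "cuts x y {j + 1, i, j} k" "cuts x y {j + 1, i, j} l"
      "k \<in> {1..n}" "l \<in> {1..n}" for k l
    using grows_unique[OF g3] that by blast
  from ey consider "\<forall>k\<in>{1..<j + 1}. y k < y (j + 1)" | "\<forall>k\<in>{1..<j + 1}. y (j + 1) < y k"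
    by (auto simp: extremal_def)
  then show ?thesis
  proof cases
    case 1
    then have top: "y k < y (j + 1)" if "1 \<le> k" "k \<le> j" for k using that by auto
    have "btw (y j) (y (j - 1)) (y (j + 1))" using j1 top[of "j - 1"] ij by (auto simp: btw_def)
    then have c: "cuts x y {j + 1, i, j} (j - 1)"
      by (intro cutsI2[of j _ "j + 1"]) (use i ij in auto)
    have n: "n = j + 1"
    proof (rule ccontr)
      assume "n \<noteq> j + 1"
      then have "j + 2 \<le> n" using ij by auto
      then have "j - 1 = j + 2" by (intro uniq3 c next3) (use ij in auto)
      then show False by simp
    qed
    have g4: "grows n (cuts x y) {j - 1, j + 1, i, j}"
      by (rule grows_insert[OF g3 c]) (use ij in auto)
    \<comment> \<open>For j = 4 only p_b is missing. It lies below and to the left of the other four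
      points, so the chain is stuck before it is full.\<close>
    have "j \<noteq> 4"
    proof
      assume j: "j = 4"
      have *: "btw (x 1) (x 3) (x 2)" "x 3 < x i" using s[of 1] xi[of 3] i by (auto simp: j)
      then have "x b < x 3" using i by (auto simp: b_def btw_def)
      have "{j - 1, j + 1, i, j} = {1..n}"
      proof (rule grows_stuck[OF g4])
        fix k assume "k \<in> {1..n}"
        show "\<not> cuts x y {j - 1, j + 1, i, j} k"
        proof (cases "k = b")
          case True
          have "x b < x a \<and> y b < y a" if "a \<in> {j - 1, j + 1, i, j}" for a
            using that \<open>x b < x 3\<close> xi[of b] yi[of b] up'[of b] j1 x1[of b] top[of b] b j by force
          then show ?thesis unfolding True cuts_def btw_def by fastforce
        next
          case False
          then have "k \<in> {j - 1, j + 1, i, j}"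
            using \<open>k \<in> {1..n}\<close> i by (auto simp: n j b_def)
          then show ?thesis by (simp add: cuts_def)
        qed
      qed
      moreover have "b \<in> {1..n}" "b \<notin> {j - 1, j + 1, i, j}" using b i j n by auto
      ultimately show False by blast
    qed
    then have j5: "5 \<le> j" using ij by auto
    then have "btw (x i) (x (j - 1)) (x (j - 2))" "x (j - 1) < x i"
      using s[of i] xi[of "j - 1"] i ij by auto
    \<comment> \<open>As p_i lies to the right of p_(j-1), the latter has p_(j-2) on its left and
      all earlier points on its right.\<close>
    then have xl: "x (j - 1) < x k" if "1 \<le> k" "k < j - 2" for k
      using s[of k] that by (auto simp: btw_def)
    have c4: "cuts x y {j - 1, j + 1, i, j} k" if "1 \<le> k" "k < j - 2" "k \<noteq> i" for k
      by (rule cutsI1[of "j - 1" _ i]) (use that xl xi[of k] in \<open>auto simp: btw_def\<close>)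
    have j: "j = 5"
    proof (rule ccontr)
      assume "j \<noteq> 5"
      then have "cuts x y {j - 1, j + 1, i, j} b" "cuts x y {j - 1, j + 1, i, j} 3"
        using c4 b j5 i by auto
      then show False using grows_unique[OF g4, of b 3] b ij by auto
    qed
    \<comment> \<open>Partners of p_6: the rows y_k < y_5 < y_4 < y_6 exclude k <= 3, and the
      columns x_4 < x_1, x_2 < x_6 exclude k = 4.\<close>
    have "\<not> grows n (cuts x y) {k, n}" if "k \<in> {1, 2, 3}" for k
      by (rule two_cutsI[of 4 5])
        (use that top[of 4] top[of 5] up'[of k] j1 in \<open>auto simp: n j btw_def\<close>)
    moreover have "\<not> grows n (cuts x y) {4, n}"
      by (rule two_cutsI[of 1 2])
        (use xl[of 1] xl[of 2] x1[of 1] x1[of 2] in \<open>auto simp: n j btw_def\<close>)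
    moreover have "k \<in> {1, 2, 3} \<or> k = 4 \<or> k = 5" if "k \<in> {1..<n}" for k
      using that by (auto simp: n j)
    ultimately have "k = 5" if "k \<in> {1..<n}" "grows n (cuts x y) {k, n}" for k
      using that by metis
    then show ?thesis using n uniq unfolding rigid_def by blast
  next
    case 2
    then have bot: "y (j + 1) < y k" if "1 \<le> k" "k \<le> j" for k using that by auto
    have c3: "cuts x y {j + 1, i, j} k" if "1 \<le> k" "k < j - 1" "k \<noteq> i" for k
      by (rule cutsI2[of "j + 1" _ i]) (use that yi[of k] bot[of k] in \<open>auto simp: btw_def\<close>)
    have j: "j = 4"
    proof (rule ccontr)
      assume "j \<noteq> 4"
      then have "cuts x y {j + 1, i, j} b" "cuts x y {j + 1, i, j} 3"
        using c3 b ij i by auto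
      then show False using uniq3[of b 3] b ij by auto
    qed
    have n: "n = j + 1"
    proof (rule ccontr)
      assume "n \<noteq> j + 1"
      then have "j + 2 \<le> n" using ij by auto
      then have "b = j + 2" by (intro uniq3 c3 next3) (use ij b j in auto)
      then show False using b ij by simp
    qed
    have *: "btw (x 1) (x 3) (x 2)" "x 3 < x i" using s[of 1] xi[of 3] i by (auto simp: j)
    then have xb: "x b < x 3" using i by (auto simp: b_def btw_def)
    \<comment> \<open>Partners of p_5: the columns x_b < x_3 < x_i < x_5 and the rows y_5 < y_b, y_i
      < y_4 < y_3 leave only k = i.\<close>
    have "\<not> grows n (cuts x y) {b, n}"
      by (rule two_cutsI[of 3 i])
        (use xb * b i xi[of b] x1[of 3] x1[of i] in \<open>auto simp: n j btw_def\<close>)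
    moreover have "\<not> grows n (cuts x y) {3, n}"
      by (rule two_cutsI[of i b])
        (use xb * b i x1[of i] bot[of b] up'[of b] j1 in \<open>auto simp: n j btw_def\<close>)
    moreover have "\<not> grows n (cuts x y) {4, n}"
      by (rule two_cutsI[of i b])
        (use b i bot[of i] bot[of b] up'[of b] up'[of i] in \<open>auto simp: n j btw_def\<close>)
    ultimately have "k = i" if "k \<in> {1..<n}" "grows n (cuts x y) {k, n}" for k
    proof (rule_tac ccontr)
      assume "k \<noteq> i"
      then have "k = b \<or> k = 3 \<or> k = 4" using that(1) i by (auto simp: n j b_def)
      then show False using that(2) \<open>\<not> grows n (cuts x y) {b, n}\<close>
          \<open>\<not> grows n (cuts x y) {3, n}\<close> \<open>\<not> grows n (cuts x y) {4, n}\<close> by blast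
    qed
    then show ?thesis using n uniq unfolding rigid_def by blast
  qed
qed

lemma separating_cases:
  assumes "separating 1 y j"
  shows "(\<forall>k\<in>{1..<j-1}. y k < y j \<and> y j < y (j-1)) \<or> (\<forall>k\<in>{1..<j-1}. y j < y k \<and> y (j-1) < y j)"
  using assms unfolding separating_def btw_def by (meson less_asym)

lemma grows_rigid:
  assumes pin: "pin_coords n x y" and g: "grows n (cuts x y) {i, j}"
    and ij: "1 \<le> i" "i < j" "4 \<le> j" "j < n"
  shows "rigid n x y i j"
proof -
  have *: "rigid n x y i j"
    if pin: "pin_coords n x y" and g: "grows n (cuts x y) {i, j}"
      and "separating 1 y j" "extremal 1 x j" for x y
  proof -
    let ?x = "\<lambda>i. - x i" and ?y = "\<lambda>i. - y i"
    note orient = grows_rigid_oriented[OF _ _ ij]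
    \<comment> \<open>One of the four reflected copies has the required orientation, and
      \<open>rigid\<close> depends on the coordinates through \<open>cuts\<close> only.\<close>
    have "rigid n x y i j \<or> rigid n ?x y i j \<or> rigid n x ?y i j \<or> rigid n ?x ?y i j"
      using separating_cases[OF that(3)] that(4) orient[of x y] orient[of ?x y]
        orient[of x ?y] orient[of ?x ?y] that(1-3)
      unfolding extremal_def
      by (simp add: cuts_neg1 cuts_neg2 pin_coords_neg1 pin_coords_neg2) blast
    then show ?thesis by (simp add: rigid_def cuts_neg1 cuts_neg2)
  qed
  have "rigid n x y i j \<or> rigid n y x i j"
    using *[of x y] *[of y x] pin g pin_coordsD[OF pin, of j] ij
    by (auto simp: cuts_swap[of y x] pin_coords_swap[of n y x])
  then show ?thesis by (simp add: rigid_def cuts_swap[of y x])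
qed

section \<open>Pairs {i, j} with j = n or j = 3, and the total number of pairs\<close>

lemma card_grows_extremal:
  assumes inj: "inj_on x {1..n}" and ext: "extremal 1 x n"
  shows "card {i\<in>{1..<n}. grows n (cuts x y) {i, n}} \<le> 2"
proof -
  let ?F = "{i\<in>{1..<n}. grows n (cuts x y) {i, n}}"
  \<comment> \<open>Here \<open>i\<close> is the partner farthest from p_n; two others in between
    would both cut \<open>{i, n}\<close>.\<close>
  have noless: False if "i \<in> ?F" "j \<in> ?F" "k \<in> ?F" "j \<noteq> k"
      "btw (x i) (x j) (x n)" "btw (x i) (x k) (x n)" for i j k
    using two_cutsI[of j k n i n x y] that by (auto simp: btw_def)
  show ?thesis
  proof (rule ccontr)
    assume "\<not> card ?F \<le> 2"
    then have "3 \<le> card ?F" by simp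
    then obtain T where "T \<subseteq> ?F" "card T = 3" by (meson obtain_subset_with_card_n)
    then obtain a b c where abc: "a \<in> ?F" "b \<in> ?F" "c \<in> ?F" "a \<noteq> b" "a \<noteq> c" "b \<noteq> c"
      by (auto simp: card_3_iff)
    then have "x a \<noteq> x b" "x a \<noteq> x c" "x b \<noteq> x c"
      using inj by (auto simp: inj_on_eq_iff)
    moreover have "(x a < x n \<and> x b < x n \<and> x c < x n) \<or> (x n < x a \<and> x n < x b \<and> x n < x c)"
      using ext abc(1-3) by (auto simp: extremal_def)
    ultimately have "(btw (x a) (x b) (x n) \<and> btw (x a) (x c) (x n)) \<or>
        (btw (x b) (x a) (x n) \<and> btw (x b) (x c) (x n)) \<or>
        (btw (x c) (x a) (x n) \<and> btw (x c) (x b) (x n))"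
      unfolding btw_def by linarith
    then show False
      using noless[of a b c] noless[of b a c] noless[of c a b] abc by blast
  qed
qed

lemma card_grows_last:
  assumes pin: "pin_coords n x y" and "4 \<le> n"
  shows "card {i\<in>{1..<n}. grows n (cuts x y) {i, n}} \<le> 2"
proof -
  have "extremal 1 x n \<or> extremal 1 y n" "inj_on x {1..n}" "inj_on y {1..n}"
    using pin_coordsD[OF pin, of n] assms by (auto simp: pin_coords_def)
  then show ?thesis
    using card_grows_extremal[of x n y] card_grows_extremal[of y n x] by (auto simp: cuts_swap[of y x])
qed

text \<open>p_4 cuts both pairs. Since p_3 is extremal in one coordinate, p_1 and p_2 lie there on
  the same side of it, and the nearer one is a second cutting point for the pair of the farther
  one.\<close>

lemma grows_third_unique:
  assumes pin: "pin_coords n x y" and "4 \<le> n"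
  shows "\<not> (grows n (cuts x y) {1, 3} \<and> grows n (cuts x y) {2, 3})"
proof -
  have four: "btw (x 1) (x 4) (x 3) \<or> btw (y 1) (y 4) (y 3)"
    "btw (x 2) (x 4) (x 3) \<or> btw (y 2) (y 4) (y 3)"
    using pin_coords_next_btw[OF pin, of 1 3] pin_coords_next_btw[OF pin, of 2 3] assms by auto
  have "x 1 \<noteq> x 2 \<and> y 1 \<noteq> y 2"
    using pin assms by (auto simp: pin_coords_def inj_on_eq_iff)
  moreover have "extremal 1 x 3 \<or> extremal 1 y 3"
    using pin_coordsD[OF pin, of 3] assms by auto
  then have "(x 1 < x 3 \<and> x 2 < x 3 \<or> x 3 < x 1 \<and> x 3 < x 2) \<or>
      (y 1 < y 3 \<and> y 2 < y 3 \<or> y 3 < y 1 \<and> y 3 < y 2)"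
    by (auto simp: extremal_def)
  ultimately have "(btw (x 1) (x 2) (x 3) \<or> btw (y 1) (y 2) (y 3)) \<or>
      (btw (x 2) (x 1) (x 3) \<or> btw (y 2) (y 1) (y 3))"
    unfolding btw_def by linarith
  then show ?thesis
    using two_cutsI[of 2 4 n 1 3 x y] two_cutsI[of 1 4 n 2 3 x y] assms(2) four by auto
qed

text \<open>Counting by j = 2, j = 3, 4 <= j < n and j = n gives 1 + 1 + 0 + 2 if the third class is
  empty. Otherwise \<open>rigid\<close> fixes j = n - 1 and the partner of j, and leaves at most one
  partner of n: 1 + 1 + 1 + 1.\<close>

lemma card_grows_pairs:
  assumes pin: "pin_coords n x y" and n: "4 \<le> n"
  shows "card {(i, j). 1 \<le> i \<and> i < j \<and> j \<le> n \<and> grows n (cuts x y) {i, j}} \<le> 4"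
proof -
  define F where "F j = {i\<in>{1..<j}. grows n (cuts x y) {i, j}}" for j
  have fin: "finite (F j)" for j by (auto simp: F_def)
  have "{(i, j). 1 \<le> i \<and> i < j \<and> j \<le> n \<and> grows n (cuts x y) {i, j}} =
      prod.swap ` (SIGMA j:{2..n}. F j)"
    by (auto simp: F_def image_iff)
  then have "card {(i, j). 1 \<le> i \<and> i < j \<and> j \<le> n \<and> grows n (cuts x y) {i, j}} =
      card (SIGMA j:{2..n}. F j)"
    by (simp add: card_image)
  also have "\<dots> = (\<Sum>j\<in>{2..n}. card (F j))"
    using fin by (intro card_SigmaI) auto
  also have "{2..n} = {2, 3} \<union> ({4..<n} \<union> {n})" using n by auto
  also have "(\<Sum>j\<in>\<dots>. card (F j)) = card (F 2) + card (F 3) + (\<Sum>j\<in>{4..<n}. card (F j)) + card (F n)"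
    using n by (subst sum.union_disjoint) (auto simp: sum.union_disjoint)
  also have "\<dots> \<le> 4"
  proof -
    have "F 2 \<subseteq> {1}" by (auto simp: F_def)
    then have F2: "card (F 2) \<le> 1" using card_mono[of "{1}" "F 2"] by simp
    have "F 3 \<subseteq> {1} \<or> F 3 \<subseteq> {2}"
    proof -
      have "F 3 \<subseteq> {1, 2}" by (auto simp: F_def)
      moreover have "\<not> (1 \<in> F 3 \<and> 2 \<in> F 3)"
        using grows_third_unique[OF pin n] by (auto simp: F_def)
      ultimately show ?thesis by blast
    qed
    then have F3: "card (F 3) \<le> 1" using card_mono[of "{1}" "F 3"] card_mono[of "{2}" "F 3"] by auto
    have Fn: "card (F n) \<le> 2" using card_grows_last[OF pin n] by (simp add: F_def)
    have rigid: "rigid n x y i j" if "j \<in> {4..<n}" "i \<in> F j" for i j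
      using grows_rigid[OF pin, of i j] that by (auto simp: F_def)
    show ?thesis
    proof (cases "\<exists>j\<in>{4..<n}. F j \<noteq> {}")
      case False
      then show ?thesis using F2 F3 Fn by simp
    next
      case True
      then obtain i j where j: "j \<in> {4..<n}" "i \<in> F j" by blast
      note r = rigid[OF this]
      have "F k = {}" if "k \<in> {4..<n} - {j}" for k
        using rigid[of k] r that by (auto simp: rigid_def)
      then have "(\<Sum>k\<in>{4..<n}. card (F k)) = card (F j)"
        using j(1) by (subst sum.remove[of _ j]) auto
      also have "F j \<subseteq> {i}" using r by (auto simp: rigid_def F_def)
      then have "card (F j) \<le> 1" using card_mono[of "{i}" "F j"] by simp
      finally have "(\<Sum>k\<in>{4..<n}. card (F k)) \<le> 1" .
      moreover have "\<forall>k\<in>F n. \<forall>k'\<in>F n. k = k'" using r by (auto simp: rigid_def F_def)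
      then have "card (F n) \<le> 1" using card_le_Suc0_iff_eq[OF fin, of n] by simp
      ultimately show ?thesis using F2 F3 by simp
    qed
  qed
  finally show ?thesis .
qed

section \<open>A pin order is determined by its first two points\<close>

lemma separating_not_btw:
  assumes "separating m x l" "a \<in> {m..<l-1}" "b \<in> {m..<l-1}"
  shows "\<not> btw (x a) (x l) (x b)"
  using assms unfolding separating_def btw_def by (meson less_asym)

lemma extremal_not_btw:
  assumes "extremal m x l" "a \<in> {m..<l}" "b \<in> {m..<l}"
  shows "\<not> btw (x a) (x l) (x b)"
  using assms unfolding extremal_def btw_def by (meson less_asym)

text \<open>The coordinates are indexed by labels of points, and \<open>r i\<close> is the label of the \<open>i\<close>-th pin.\<close>

definition pin_order :: "nat \<Rightarrow> (nat \<Rightarrow> real) \<Rightarrow> (nat \<Rightarrow> real) \<Rightarrow> (nat \<Rightarrow> nat) \<Rightarrow> bool" where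
  "pin_order n x y r \<longleftrightarrow> bij_betw r {1..n} {1..n} \<and> pin_coords n (\<lambda>i. x (r i)) (\<lambda>i. y (r i))"

text \<open>p_(k+1) lies between p_1 and p_k in one coordinate. For l > k + 1, p_l separates only
  p_(l-1) from its predecessors and is extremal in the other coordinate, so in both coordinates the
  first k pins lie on the same side of it.\<close>

lemma pin_order_cuts_iff:
  assumes r: "pin_order n x y r" and k: "2 \<le> k" "k < n" and m: "m \<in> {1..n}"
  shows "cuts x y (r ` {1..k}) m \<longleftrightarrow> m = r (k + 1)"
proof -
  have bij: "bij_betw r {1..n} {1..n}" and pin: "pin_coords n (\<lambda>i. x (r i)) (\<lambda>i. y (r i))"
    using r by (auto simp: pin_order_def)
  from bij m have "m \<in> r ` {1..n}" by (simp add: bij_betw_def)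
  then obtain l where l: "l \<in> {1..n}" "m = r l" by blast
  have inj: "r a = r b \<longleftrightarrow> a = b" if "a \<in> {1..n}" "b \<in> {1..n}" for a b
    using bij that by (auto simp: bij_betw_def inj_on_eq_iff)
  have nin: "r a \<notin> r ` {1..k}" if "k < a" "a \<le> n" for a
    using inj that k by auto
  consider "l \<le> k" | "l = k + 1" | "k + 1 < l" by linarith
  then show ?thesis
  proof cases
    case 1
    then have "r l \<in> r ` {1..k}" using l by auto
    then show ?thesis using inj[of l "k + 1"] l k 1 by (auto simp: cuts_def)
  next
    case 2
    have "btw (x (r 1)) (x (r (k + 1))) (x (r k)) \<or> btw (y (r 1)) (y (r (k + 1))) (y (r k))"
      using pin_coords_next_btw[OF pin, of 1 k] k by auto
    moreover have "r 1 \<in> r ` {1..k}" "r k \<in> r ` {1..k}" using k by auto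
    ultimately show ?thesis using nin[of "k + 1"] k l 2 unfolding cuts_def by auto
  next
    case 3
    have "\<not> btw (x (r a)) (x (r l)) (x (r b)) \<and> \<not> btw (y (r a)) (y (r l)) (y (r b))"
      if "a \<in> {1..k}" "b \<in> {1..k}" for a b
    proof -
      have "a \<in> {1..<l-1}" "b \<in> {1..<l-1}" "a \<in> {1..<l}" "b \<in> {1..<l}" using that 3 by auto
      moreover have "3 \<le> l" "l \<le> n" using 3 k l by auto
      ultimately show ?thesis
        using pin_coordsD[OF pin, of l] separating_not_btw[of 1 "\<lambda>i. x (r i)" l a b]
          separating_not_btw[of 1 "\<lambda>i. y (r i)" l a b]
          extremal_not_btw[of 1 "\<lambda>i. x (r i)" l a b]
          extremal_not_btw[of 1 "\<lambda>i. y (r i)" l a b] by blast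
    qed
    then show ?thesis using inj[of l "k + 1"] l k 3 by (auto simp: cuts_def)
  qed
qed

lemma image_atLeastAtMost_Suc: "f ` {1..Suc k} = insert (f (Suc k)) (f ` {1..k})"
  by (simp add: atLeastAtMostSuc_conv)

lemma pin_order_grows:
  assumes r: "pin_order n x y r" and k: "2 \<le> k" "k \<le> n"
  shows "grows n (cuts x y) (r ` {1..k})"
  using k(2,1)
proof (induction k rule: inc_induct)
  case base
  have "r ` {1..n} = {1..n}" using r by (auto simp: pin_order_def bij_betw_def)
  then show ?case by (simp only: grows.full)
next
  case (step k)
  have mem: "r (k + 1) \<in> {1..n}"
    using r step by (auto simp: pin_order_def bij_betw_def)
  note iff = pin_order_cuts_iff[OF r step.prems step.hyps(2)]
  show ?case
  proof (rule grows.step[of "r (k + 1)"])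
    show "cuts x y (r ` {1..k}) (r (k + 1))" using iff[OF mem] by simp
    show "m = r (k + 1)" if "m \<in> {1..n}" "cuts x y (r ` {1..k}) m" for m
      using iff[OF that(1)] that(2) by simp
    show "grows n (cuts x y) (insert (r (k + 1)) (r ` {1..k}))"
      using step image_atLeastAtMost_Suc[of r k] by simp
  qed (rule mem)
qed

text \<open>The set of the first k pins determines the next pin as its only cutting point, so the
  order can be rebuilt from its first two points.\<close>

lemma pin_order_unique:
  assumes r: "pin_order n x y r" and r': "pin_order n x y r'"
    and eq: "r 1 = r' 1" "r 2 = r' 2" and i: "i \<in> {1..n}"
  shows "r i = r' i"
proof -
  have "i \<in> {1..n} \<longrightarrow> r i = r' i"
  proof (induction i rule: less_induct)
    case (less i)
    show ?case
    proof (cases "i \<le> 2")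
      case True
      then consider "i = 0" | "i = 1" | "i = 2" by linarith
      then show ?thesis using eq by cases auto
    next
      case False
      show ?thesis
      proof
        assume i: "i \<in> {1..n}"
        define k where "k = i - 1"
        have k: "i = k + 1" "2 \<le> k" "k < n" using False i by (auto simp: k_def)
        have "r ` {1..k} = r' ` {1..k}"
          using less.IH k by (intro image_cong) auto
        moreover have "r i \<in> {1..n}"
          using r i by (auto simp: pin_order_def bij_betw_def)
        ultimately show "r i = r' i"
          using pin_order_cuts_iff[OF r k(2,3), of "r i"] pin_order_cuts_iff[OF r' k(2,3), of "r i"]
            k(1) by simp
      qed
    qed
  qed
  with i show ?thesis by blast
qed

text \<open>Only relative order matters, so the condition passes from the real coordinates of the
  pins to the columns and rows of the diagram.\<close>

lemma pin_coords_cong: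
  assumes pin: "pin_coords n x y"
    and "\<And>i j. i \<in> {1..n} \<Longrightarrow> j \<in> {1..n} \<Longrightarrow> x i < x j \<longleftrightarrow> x' i < x' j"
    and "\<And>i j. i \<in> {1..n} \<Longrightarrow> j \<in> {1..n} \<Longrightarrow> y i < y j \<longleftrightarrow> y' i < y' j"
  shows "pin_coords n x' y'"
proof -
  have inj: "inj_on u' {1..n}" and sep: "l \<in> {3..n} \<Longrightarrow> separating 1 u' l = separating 1 u l"
    and ext: "l \<in> {3..n} \<Longrightarrow> extremal 1 u' l = extremal 1 u l"
    if u: "inj_on u {1..n}" "\<And>i j. i \<in> {1..n} \<Longrightarrow> j \<in> {1..n} \<Longrightarrow> u i < u j \<longleftrightarrow> u' i < u' j"
    for u u' :: "nat \<Rightarrow> real" and l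
  proof -
    show "inj_on u' {1..n}"
    proof (rule inj_onI)
      fix i j assume "i \<in> {1..n}" "j \<in> {1..n}" "u' i = u' j"
      then have "u i = u j" using u(2)[of i j] u(2)[of j i] by simp
      then show "i = j" using u(1) \<open>i \<in> _\<close> \<open>j \<in> _\<close> by (simp add: inj_on_eq_iff)
    qed
    assume l: "l \<in> {3..n}"
    show "separating 1 u' l = separating 1 u l"
      unfolding separating_def btw_def by (intro ball_cong refl) (use l u(2) in auto)
    have "(\<forall>k\<in>{1..<l}. u' k < u' l) = (\<forall>k\<in>{1..<l}. u k < u l)"
      "(\<forall>k\<in>{1..<l}. u' l < u' k) = (\<forall>k\<in>{1..<l}. u l < u k)"
      by (intro ball_cong refl; use l u(2) in auto)+
    then show "extremal 1 u' l = extremal 1 u l" by (simp add: extremal_def)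
  qed
  have "inj_on x {1..n}" "inj_on y {1..n}" using pin by (auto simp: pin_coords_def)
  note X = inj[OF this(1) assms(2)] sep[OF this(1) assms(2)] ext[OF this(1) assms(2)]
    and Y = inj[OF this(2) assms(3)] sep[OF this(2) assms(3)] ext[OF this(2) assms(3)]
  show ?thesis using pin X Y by (simp add: pin_coords_def)
qed

lemma card_pin_order_starts:
  assumes n: "4 \<le> n"
  shows "finite {(r 1, r 2) | r. pin_order n x y r}" (is "finite ?P")
    and "card {(r 1, r 2) | r. pin_order n x y r} \<le> 8"
proof -
  have "?P \<subseteq> {1..n} \<times> {1..n}"
    using n by (auto simp: pin_order_def bij_betw_def)
  then show "finite ?P" by (rule finite_subset) simp
  show "card ?P \<le> 8"
  proof (cases "\<exists>s. pin_order n x y s")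
    case False
    then have "?P = {}" by blast
    then show ?thesis by simp
  next
    case True
    then obtain s where s: "pin_order n x y s" by blast
    \<comment> \<open>Relabelling the points along one pin order \<open>s\<close> turns
      \<open>s\<close> into the identity, which is the setting of
      \<open>card_grows_pairs\<close>.\<close>
    define x' y' where "x' = (\<lambda>i. x (s i))" and "y' = (\<lambda>i. y (s i))"
    have bij: "bij_betw s {1..n} {1..n}" and pin: "pin_coords n x' y'"
      using s by (auto simp: pin_order_def x'_def y'_def)
    define A where "A = {(i, j). 1 \<le> i \<and> i < j \<and> j \<le> n \<and> grows n (cuts x' y') {i, j}}"
    have A: "card A \<le> 4" using card_grows_pairs[OF pin n] by (simp add: A_def)
    have "A \<subseteq> {1..n} \<times> {1..n}" by (auto simp: A_def)
    then have finA: "finite A" by (rule finite_subset) simp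
    \<comment> \<open>\<open>A\<close> holds increasing pairs only; each accounts for two ordered
      starts.\<close>
    let ?f = "\<lambda>(i, j). (s i, s j)" and ?g = "\<lambda>(i, j). (s j, s i)"
    have "?P \<subseteq> ?f ` A \<union> ?g ` A"
    proof
      fix p assume "p \<in> ?P"
      then obtain q where q: "pin_order n x y q" "p = (q 1, q 2)" by blast
      define r where "r = (\<lambda>i. inv_into {1..n} s (q i))"
      have bq: "bij_betw q {1..n} {1..n}" using q by (simp add: pin_order_def)
      have "bij_betw (inv_into {1..n} s \<circ> q) {1..n} {1..n}"
        by (rule bij_betw_trans[OF bq bij_betw_inv_into[OF bij]])
      then have br: "bij_betw r {1..n} {1..n}" by (simp add: r_def comp_def)
      have sr: "s (r i) = q i" if "i \<in> {1..n}" for i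
        unfolding r_def by (rule bij_betw_inv_into_right[OF bij]) (use bq that in \<open>auto simp: bij_betw_def\<close>)
      have "pin_coords n (\<lambda>i. x' (r i)) (\<lambda>i. y' (r i))"
        by (rule pin_coords_cong[of n "\<lambda>i. x (q i)" "\<lambda>i. y (q i)"])
          (use q sr in \<open>auto simp: pin_order_def x'_def y'_def\<close>)
      then have r: "pin_order n x' y' r" using br by (simp add: pin_order_def)
      have "{1..2::nat} = {1, 2}" by auto
      then have g: "grows n (cuts x' y') {r 1, r 2}"
        using pin_order_grows[OF r, of 2] n by simp
      have "r 1 \<in> {1..n}" "r 2 \<in> {1..n}" "r 1 \<noteq> r 2"
        using br n by (auto simp: bij_betw_def inj_on_eq_iff)
      then have "(r 1, r 2) \<in> A \<or> (r 2, r 1) \<in> A"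
        using g by (auto simp: A_def insert_commute)
      moreover have "p = (s (r 1), s (r 2))" using sr q n by auto
      ultimately show "p \<in> ?f ` A \<union> ?g ` A" by force
    qed
    then have "card ?P \<le> card (?f ` A \<union> ?g ` A)"
      by (rule card_mono[rotated]) (use finA in auto)
    also have "\<dots> \<le> card (?f ` A) + card (?g ` A)" by (rule card_Un_le)
    also have "\<dots> \<le> card A + card A" by (intro add_mono card_image_le finA)
    finally show ?thesis using A by simp
  qed
qed

section \<open>Pin sequences of simple permutations\<close>

lemma bounding_box_iff:
  assumes "finite S" "S \<noteq> {}"
  shows "q \<in> bounding_box S \<longleftrightarrow> (\<exists>a\<in>S. fst a \<le> fst q) \<and> (\<exists>a\<in>S. fst q \<le> fst a) \<and>
    (\<exists>a\<in>S. snd a \<le> snd q) \<and> (\<exists>a\<in>S. snd q \<le> snd a)"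
  using assms by (cases q) (auto simp: bounding_box_def Min_le_iff Max_ge_iff)

lemma subset_bounding_box: "finite S \<Longrightarrow> S \<subseteq> bounding_box S"
proof
  fix q assume "finite S" "q \<in> S"
  then show "q \<in> bounding_box S" by (subst bounding_box_iff) auto
qed

lemma not_bounding_box_extremal:
  assumes "p l \<notin> bounding_box (p ` {m..<l})" "m < l"
  shows "extremal m (\<lambda>i. fst (p i)) l \<or> extremal m (\<lambda>i. snd (p i)) l"
proof -
  have "finite (p ` {m..<l})" "p ` {m..<l} \<noteq> {}" using assms(2) by auto
  then show ?thesis
    using assms(1) unfolding bounding_box_iff[OF \<open>finite _\<close> \<open>_ \<noteq> {}\<close>] extremal_def
    by (simp add: not_le) blast
qed

lemma separating_not_extremal:
  assumes "separating m x l" "m < l - 1"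
  shows "\<not> extremal m x l"
proof -
  have "btw (x m) (x l) (x (l - 1))" using assms by (auto simp: separating_def)
  moreover have "m \<in> {m..<l}" "l - 1 \<in> {m..<l}" using assms(2) by auto
  ultimately show ?thesis unfolding extremal_def btw_def by (meson less_asym)
qed

lemma separating_mono: "separating m x l \<Longrightarrow> m \<le> m' \<Longrightarrow> separating m' x l"
  by (auto simp: separating_def)

lemma extremal_mono: "extremal m x l \<Longrightarrow> m \<le> m' \<Longrightarrow> extremal m' x l"
  by (auto simp: extremal_def)

lemma separates_separating:
  assumes "separates (p l) {p (l - 1)} (p ` {m..<l - 1})"
  shows "m < l - 1" "separating m (\<lambda>i. fst (p i)) l \<or> separating m (\<lambda>i. snd (p i)) l"
proof -
  have "p ` {m..<l - 1} \<noteq> {}" using assms unfolding separates_def by blast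
  then show "m < l - 1" by simp
  show "separating m (\<lambda>i. fst (p i)) l \<or> separating m (\<lambda>i. snd (p i)) l"
    using assms unfolding separates_def separating_def btw_def by auto
qed

text \<open>If a coordinate had points on both sides of p_l, the two sides would form a splitting;
  by \<open>ne\<close> no point lies on the line, so they exhaust the set.\<close>

lemma not_splits_extremal:
  assumes ns: "\<not> splits (p l) (p ` {m..<l})"
    and ne: "\<And>k. k \<in> {m..<l} \<Longrightarrow> fst (p k) \<noteq> fst (p l) \<and> snd (p k) \<noteq> snd (p l)"
  shows "extremal m (\<lambda>i. fst (p i)) l \<and> extremal m (\<lambda>i. snd (p i)) l"
proof -
  have *: "extremal m (\<lambda>i. c (p i)) l" if c: "c = fst \<or> c = snd" for c :: "point \<Rightarrow> real"
  proof (rule ccontr)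
    assume "\<not> ?thesis"
    moreover have cne: "c (p k) \<noteq> c (p l)" if "k \<in> {m..<l}" for k using ne[OF that] c by auto
    ultimately obtain a b where ab: "a \<in> {m..<l}" "c (p a) < c (p l)" "b \<in> {m..<l}" "c (p l) < c (p b)"
      unfolding extremal_def by (metis linorder_neqE)
    define A B where "A = {q \<in> p ` {m..<l}. c q < c (p l)}" and "B = {q \<in> p ` {m..<l}. c (p l) < c q}"
    have "A \<union> B = p ` {m..<l}" using cne unfolding A_def B_def neq_iff by blast
    moreover have "A \<noteq> {}" "B \<noteq> {}" using ab unfolding A_def B_def by blast+
    moreover have "\<forall>a\<in>A. \<forall>b\<in>B. c a < c (p l) \<and> c (p l) < c b" by (auto simp: A_def B_def)
    ultimately have "splits (p l) (p ` {m..<l})"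
      using c unfolding splits_def separates_def by blast
    with ns show False ..
  qed
  show ?thesis using *[of fst] *[of snd] by simp
qed

text \<open>A separating pin lies between earlier points in one coordinate, so being outside the
  bounding box makes it extremal in the other. A pin that splits nothing is extremal in
  both.\<close>

lemma pin_sequence_step:
  assumes p: "pin_sequence m n p" and l: "m < l" "l \<le> n"
  shows "(separating m (\<lambda>i. fst (p i)) l \<and> extremal m (\<lambda>i. snd (p i)) l \<or>
      separating m (\<lambda>i. snd (p i)) l \<and> extremal m (\<lambda>i. fst (p i)) l) \<or>
    (\<not> splits (p l) (p ` {m..<l}) \<and>
      extremal m (\<lambda>i. fst (p i)) l \<and> extremal m (\<lambda>i. snd (p i)) l)"
proof -
  have "l \<in> {m<..n}" using l by auto
  then have bb: "p l \<notin> bounding_box (p ` {m..<l})"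
    and s: "separates (p l) {p (l - 1)} (p ` {m..<l - 1}) \<or> \<not> splits (p l) (p ` {m..<l})"
    using p unfolding pin_sequence_def by blast+
  from s show ?thesis
  proof
    assume sep: "separates (p l) {p (l - 1)} (p ` {m..<l - 1})"
    note separates_separating[OF this]
    then show ?thesis
      using not_bounding_box_extremal[OF bb l(1)]
        separating_not_extremal[of m "\<lambda>i. fst (p i)" l]
        separating_not_extremal[of m "\<lambda>i. snd (p i)" l] by blast
  next
    assume ns: "\<not> splits (p l) (p ` {m..<l})"
    have "fst (p k) \<noteq> fst (p l) \<and> snd (p k) \<noteq> snd (p l)" if "k \<in> {m..<l}" for k
    proof -
      have "k \<in> {m..n}" "l \<in> {m..n}" "k \<noteq> l" using that l by auto
      then show ?thesis using p unfolding pin_sequence_def by blast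
    qed
    then show ?thesis using not_splits_extremal[OF ns] ns by blast
  qed
qed

text \<open>\<open>g i\<close> is the column of the diagram point matched with the i-th pin; it
  replaces the order isomorphism by a map of indices.\<close>

definition realizes :: "nat \<Rightarrow> (nat \<Rightarrow> nat) \<Rightarrow> (nat \<Rightarrow> point) \<Rightarrow> (nat \<Rightarrow> nat) \<Rightarrow> bool" where
  "realizes n \<pi> p g \<longleftrightarrow> bij_betw g {1..n} {1..n} \<and>
     (\<forall>i\<in>{1..n}. \<forall>j\<in>{1..n}. (fst (p i) < fst (p j) \<longleftrightarrow> g i < g j) \<and>
        (snd (p i) < snd (p j) \<longleftrightarrow> \<pi> (g i) < \<pi> (g j)))"

lemma pin_representation_realizes:
  assumes "pin_representation n \<pi> p"
  shows "\<exists>g. realizes n \<pi> p g"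
proof -
  define d where "d = (\<lambda>i. (real i, real (\<pi> i)))"
  have seq: "pin_sequence 1 n p" and "order_isomorphic (p ` {1..n}) (d ` {1..n})"
    using assms by (simp_all add: pin_representation_def diagram_def d_def)
  then obtain f where f: "bij_betw f (p ` {1..n}) (d ` {1..n})"
    and ord: "\<forall>a\<in>p ` {1..n}. \<forall>b\<in>p ` {1..n}. (fst a < fst b \<longleftrightarrow> fst (f a) < fst (f b)) \<and>
        (snd a < snd b \<longleftrightarrow> snd (f a) < snd (f b))"
    unfolding order_isomorphic_def by blast
  have "inj_on p {1..n}"
  proof (rule inj_onI)
    fix i j assume "i \<in> {1..n}" "j \<in> {1..n}" "p i = p j"
    then show "i = j" using seq unfolding pin_sequence_def by metis
  qed
  then have bp: "bij_betw p {1..n} (p ` {1..n})" by (simp add: bij_betw_def)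
  have bd: "bij_betw d {1..n} (d ` {1..n})" by (auto simp: bij_betw_def inj_on_def d_def)
  define g where "g = inv_into {1..n} d \<circ> (f \<circ> p)"
  have bg: "bij_betw g {1..n} {1..n}"
    unfolding g_def by (intro bij_betw_trans[OF bij_betw_trans[OF bp f]] bij_betw_inv_into bd)
  have dg: "d (g i) = f (p i)" if "i \<in> {1..n}" for i
  proof -
    have "f (p i) \<in> d ` {1..n}" using f that by (auto simp: bij_betw_def)
    then show ?thesis by (simp only: g_def comp_def f_inv_into_f)
  qed
  have "(fst (p i) < fst (p j) \<longleftrightarrow> g i < g j) \<and> (snd (p i) < snd (p j) \<longleftrightarrow> \<pi> (g i) < \<pi> (g j))"
    if "i \<in> {1..n}" "j \<in> {1..n}" for i j
  proof -
    have "(fst (p i) < fst (p j) \<longleftrightarrow> fst (d (g i)) < fst (d (g j))) \<and>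
        (snd (p i) < snd (p j) \<longleftrightarrow> snd (d (g i)) < snd (d (g j)))"
      using ord that by (simp only: dg) blast
    then show ?thesis by (simp add: d_def)
  qed
  then have "realizes n \<pi> p g" using bg unfolding realizes_def by blast
  then show ?thesis by blast
qed

lemma convex_nat_set:
  fixes S :: "nat set"
  assumes "finite S" "S \<noteq> {}" "\<And>a b v. a \<in> S \<Longrightarrow> b \<in> S \<Longrightarrow> a < v \<Longrightarrow> v < b \<Longrightarrow> v \<in> S"
  shows "S = {Min S..Max S}"
proof
  show "S \<subseteq> {Min S..Max S}" using assms(1) by auto
  show "{Min S..Max S} \<subseteq> S"
  proof
    fix v assume "v \<in> {Min S..Max S}"
    moreover have "Min S \<in> S" "Max S \<in> S" using assms(1,2) by auto
    ultimately show "v \<in> S"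
      using assms(3)[of "Min S" "Max S" v] by (cases "v = Min S \<or> v = Max S") auto
  qed
qed

text \<open>Otherwise \<open>p 1, \<dots>, p k\<close> would form a nontrivial block.\<close>

lemma simple_permutation_cut:
  assumes simple: "simple_permutation n \<pi>" and g: "realizes n \<pi> p g" and k: "2 \<le> k" "k < n"
  shows "\<exists>l\<in>{k<..n}. \<exists>a\<in>{1..k}. \<exists>b\<in>{1..k}.
    btw (fst (p a)) (fst (p l)) (fst (p b)) \<or> btw (snd (p a)) (snd (p l)) (snd (p b))"
proof (rule ccontr)
  assume no: "\<not> ?thesis"
  have perm: "\<pi> permutes {1..n}" using simple by (simp add: simple_permutation_def)
  have bij: "bij_betw g {1..n} {1..n}"
    and ord: "\<And>i j. i \<in> {1..n} \<Longrightarrow> j \<in> {1..n} \<Longrightarrow> fst (p i) < fst (p j) \<longleftrightarrow> g i < g j"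
      "\<And>i j. i \<in> {1..n} \<Longrightarrow> j \<in> {1..n} \<Longrightarrow> snd (p i) < snd (p j) \<longleftrightarrow> \<pi> (g i) < \<pi> (g j)"
    using g unfolding realizes_def by blast+
  \<comment> \<open>Used for \<open>g\<close> and for \<open>\<pi> \<circ> g\<close>: as no later
    pin comes between two of the first k, their columns and their rows form intervals.\<close>
  have conv: "h ` {1..k} = {Min (h ` {1..k})..Max (h ` {1..k})}"
    if h: "bij_betw h {1..n} {1..n}"
      "\<And>l a b. l \<in> {k<..n} \<Longrightarrow> a \<in> {1..k} \<Longrightarrow> b \<in> {1..k} \<Longrightarrow> \<not> (h a < h l \<and> h l < h b)" for h
  proof (rule convex_nat_set)
    show "finite (h ` {1..k})" "h ` {1..k} \<noteq> {}" using k by auto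
    fix u v w assume uw: "u \<in> h ` {1..k}" "w \<in> h ` {1..k}" "u < v" "v < w"
    then obtain a b where ab: "a \<in> {1..k}" "u = h a" "b \<in> {1..k}" "w = h b" by blast
    have "a \<in> {1..n}" "b \<in> {1..n}" using ab k by auto
    then have "u \<in> {1..n}" "w \<in> {1..n}" using h(1) ab unfolding bij_betw_def by blast+
    then have "v \<in> h ` {1..n}" using uw h(1) by (simp add: bij_betw_def)
    then obtain l where "l \<in> {1..n}" "v = h l" by blast
    then show "v \<in> h ` {1..k}" using h(2)[of l a b] uw ab by (cases "l \<le> k") auto
  qed
  have in_n: "{1..k} \<subseteq> {1..n}" "{k<..n} \<subseteq> {1..n}" using k by auto
  have bij2: "bij_betw (\<pi> \<circ> g) {1..n} {1..n}"
    using bij_betw_trans[OF bij permutes_imp_bij[OF perm]] .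
  have cg: "g ` {1..k} = {Min (g ` {1..k})..Max (g ` {1..k})}"
  proof (rule conv[OF bij], rule notI)
    fix l a b assume lab: "l \<in> {k<..n}" "a \<in> {1..k}" "b \<in> {1..k}" and "g a < g l \<and> g l < g b"
    then have "btw (fst (p a)) (fst (p l)) (fst (p b))"
      using ord(1)[of a l] ord(1)[of l b] k by (auto simp: btw_def)
    then show False using no lab by blast
  qed
  have cp: "(\<pi> \<circ> g) ` {1..k} = {Min ((\<pi> \<circ> g) ` {1..k})..Max ((\<pi> \<circ> g) ` {1..k})}"
  proof (rule conv[OF bij2], rule notI)
    fix l a b assume lab: "l \<in> {k<..n}" "a \<in> {1..k}" "b \<in> {1..k}"
      and "(\<pi> \<circ> g) a < (\<pi> \<circ> g) l \<and> (\<pi> \<circ> g) l < (\<pi> \<circ> g) b"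
    then have "btw (snd (p a)) (snd (p l)) (snd (p b))"
      using ord(2)[of a l] ord(2)[of l b] k by (auto simp: btw_def)
    then show False using no lab by blast
  qed
  have card: "card (g ` {1..k}) = k"
    using inj_on_subset[OF bij_betw_imp_inj_on[OF bij] in_n(1)] by (simp add: card_image)
  have sub: "g ` {1..k} \<subseteq> {1..n}" using bij in_n(1) unfolding bij_betw_def by blast
  have ne: "g ` {1..k} \<noteq> {}" using k by auto
  have "Min (g ` {1..k}) \<in> {1..n}" "Max (g ` {1..k}) \<in> {1..n}"
    using sub Min_in[OF _ ne] Max_in[OF _ ne] by blast+
  moreover have "Min (g ` {1..k}) \<le> Max (g ` {1..k})" using ne cg by auto
  ultimately have "block n \<pi> (g ` {1..k})"
    using cg cp unfolding block_def image_comp[symmetric] by (metis atLeastAtMost_iff)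
  then have "(\<exists>i. g ` {1..k} = {i}) \<or> g ` {1..k} = {1..n}"
    using simple by (simp add: simple_permutation_def)
  then have "k = 1 \<or> k = n" using card by auto
  then show False using k by auto
qed

text \<open>Otherwise p_l lies in a corner of all earlier points and cuts nothing among p_1, ...,
  p_(l-1). Later pins separate a predecessor of index at least l, so they do not come between two of
  these points either. With l >= 3 this contradicts \<open>simple_permutation_cut\<close>.\<close>

lemma simple_pin_splits:
  assumes simple: "simple_permutation n \<pi>" and g: "realizes n \<pi> p g"
    and p: "pin_sequence 0 n p" and l: "3 \<le> l" "l \<le> n"
  shows "splits (p l) (p ` {0..<l})"
proof (rule ccontr)
  assume ns: "\<not> splits (p l) (p ` {0..<l})"
  have "2 \<le> l - 1" "l - 1 < n" using l by auto
  from simple_permutation_cut[OF simple g this] obtain m a b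
    where m: "m \<in> {l - 1<..n}" and ab: "a \<in> {1..l - 1}" "b \<in> {1..l - 1}"
      and cut: "btw (fst (p a)) (fst (p m)) (fst (p b)) \<or> btw (snd (p a)) (snd (p m)) (snd (p b))"
    by blast
  have ab': "a \<in> {0..<m}" "b \<in> {0..<m}" using ab m l by auto
  note ext = extremal_not_btw[OF _ ab', of "\<lambda>i. fst (p i)"] extremal_not_btw[OF _ ab', of "\<lambda>i. snd (p i)"]
  show False
  proof (cases "m = l")
    case True
    have "fst (p k) \<noteq> fst (p l) \<and> snd (p k) \<noteq> snd (p l)" if "k \<in> {0..<l}" for k
    proof -
      have "k \<in> {0..n}" "l \<in> {0..n}" "k \<noteq> l" using that l by auto
      then show ?thesis using p unfolding pin_sequence_def by blast
    qed
    from not_splits_extremal[OF ns this] show False using ext cut True by blast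
  next
    case False
    then have ab'': "a \<in> {0..<m-1}" "b \<in> {0..<m-1}" using ab m l by auto
    note sep = separating_not_btw[OF _ ab'', of "\<lambda>i. fst (p i)"] separating_not_btw[OF _ ab'', of "\<lambda>i. snd (p i)"]
    have "0 < m" "m \<le> n" using m by auto
    from pin_sequence_step[OF p this] show False using ext sep cut by blast
  qed
qed

lemma simple_pin_step:
  assumes simple: "simple_permutation n \<pi>" and g: "realizes n \<pi> p g"
    and p: "pin_sequence 0 n p" and l: "3 \<le> l" "l \<le> n"
  shows "separating 0 (\<lambda>i. fst (p i)) l \<and> extremal 0 (\<lambda>i. snd (p i)) l \<or>
      separating 0 (\<lambda>i. snd (p i)) l \<and> extremal 0 (\<lambda>i. fst (p i)) l"
  using pin_sequence_step[OF p, of l] simple_pin_splits[OF assms] l by auto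

lemma simple_pin_order:
  assumes simple: "simple_permutation n \<pi>" and g: "realizes n \<pi> p g" and p: "pin_sequence 0 n p"
  shows "pin_order n real (\<lambda>v. real (\<pi> v)) g"
proof -
  have "\<forall>i\<in>{1..n}. \<forall>j\<in>{1..n}. i \<noteq> j \<longrightarrow> fst (p i) \<noteq> fst (p j) \<and> snd (p i) \<noteq> snd (p j)"
    using p by (auto simp: pin_sequence_def)
  then have "inj_on (\<lambda>i. fst (p i)) {1..n}" "inj_on (\<lambda>i. snd (p i)) {1..n}"
    unfolding inj_on_def by blast+
  moreover have "separating 1 (\<lambda>i. fst (p i)) l \<and> extremal 1 (\<lambda>i. snd (p i)) l \<or>
      separating 1 (\<lambda>i. snd (p i)) l \<and> extremal 1 (\<lambda>i. fst (p i)) l" if "l \<in> {3..n}" for l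
    using simple_pin_step[OF assms, of l] that
      separating_mono[of 0 _ l 1] extremal_mono[of 0 _ l 1] by auto
  ultimately have "pin_coords n (\<lambda>i. fst (p i)) (\<lambda>i. snd (p i))"
    by (simp add: pin_coords_def)
  then have "pin_coords n (\<lambda>i. real (g i)) (\<lambda>i. real (\<pi> (g i)))"
    by (rule pin_coords_cong) (use g in \<open>auto simp: realizes_def\<close>)
  then show ?thesis using g by (simp add: pin_order_def realizes_def)
qed

section \<open>Counting pin words\<close>

lemma in_position_mono: "in_position c q T \<Longrightarrow> S \<subseteq> T \<Longrightarrow> in_position c q S"
  by (cases c) (auto simp: above_def below_def left_of_def right_of_def)

lemma encodes_in_position:
  assumes "encodes p l c"
  shows "in_position c (p l) (p ` {0..<l})"
  using assms in_position_mono[OF _ subset_bounding_box] by (auto simp: encodes_def)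

section \<open>The first two letters of a pin word\<close>

definition quadrant :: "bool \<Rightarrow> bool \<Rightarrow> pin_letter" where
  "quadrant r u = (if r then if u then N1 else N4 else if u then N2 else N3)"

text \<open>\<open>r\<close> and \<open>u\<close>: \<open>p 2\<close> lies to the right of, above \<open>p 1\<close>; \<open>v\<close>: \<open>p 3\<close> separates them by a vertical line, so
  \<open>p 0\<close> and \<open>p 1\<close> lie on the same side of it. Six of the nine cells for \<open>p 0\<close> remain.\<close>

definition first_letters :: "bool \<Rightarrow> bool \<Rightarrow> bool \<Rightarrow> (pin_letter \<times> pin_letter) set" where
  "first_letters r u v = numerals \<times> {quadrant r u} \<union>
     (if v then {quadrant True (\<not> u), quadrant False (\<not> u)} \<times> {if r then R else L}
      else {quadrant (\<not> r) True, quadrant (\<not> r) False} \<times> {if u then U else D})"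

lemma card_first_letters: "finite (first_letters r u v)" "card (first_letters r u v) \<le> 6"
proof -
  show "finite (first_letters r u v)" by (simp add: first_letters_def numerals_def)
  have "card (first_letters r u v) \<le> card (numerals \<times> {quadrant r u}) +
      card (if v then {quadrant True (\<not> u), quadrant False (\<not> u)} \<times> {if r then R else L}
        else {quadrant (\<not> r) True, quadrant (\<not> r) False} \<times> {if u then U else D})"
    unfolding first_letters_def by (rule card_Un_le)
  also have "\<dots> \<le> 4 + 2"
    by (rule add_mono) (auto simp: numerals_def card_insert_if)
  finally show "card (first_letters r u v) \<le> 6" by simp
qed

lemma encodes_1:
  assumes "encodes p (Suc 0) a"
  shows "a \<in> numerals" "in_position a (p 1) {p 0}"
proof -
  \<comment> \<open>For the first pin, the set to be separated from p_0 is empty, so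
    \<open>separates\<close> fails.\<close>
  have "a \<notin> directions" using assms by (auto simp: encodes_def separates_def)
  then show "a \<in> numerals" by (cases a) (auto simp: numerals_def directions_def)
  show "in_position a (p 1) {p 0}" using encodes_in_position[OF assms] by simp
qed

text \<open>A numeral \<open>b\<close> is the quadrant of p_2 seen from p_1, with \<open>a\<close>
  free. If \<open>b\<close> is a direction and p_3 separates by a vertical line, then p_0 and p_1
  lie on the same side of p_2 horizontally, so \<open>b\<close> is \<open>R\<close> or
  \<open>L\<close> according to p_1. The row of p_2 then lies between those of p_0 and p_1, which
  fixes the vertical half of \<open>a\<close>.\<close>

lemma encodes_first_letters:
  assumes a: "encodes p (Suc 0) a" and b: "encodes p (Suc (Suc 0)) b"
    and s: "separating 0 (\<lambda>i. if v then fst (p i) else snd (p i)) 3"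
  shows "(a, b) \<in> first_letters (fst (p 1) < fst (p 2)) (snd (p 1) < snd (p 2)) v"
proof -
  have ib: "in_position b (p 2) {p 0, p 1}"
    using encodes_in_position[OF b] by (simp add: numeral_2_eq_2 atLeast0_lessThan_Suc insert_commute)
  have sb: "separates (p 2) {p 1} {p 0}" if "b \<in> directions"
    using b that by (auto simp: encodes_def numeral_2_eq_2 atLeast0_lessThan_Suc)
  have "btw (if v then fst (p k) else snd (p k)) (if v then fst (p 3) else snd (p 3))
      (if v then fst (p 2) else snd (p 2))" if "k \<in> {0..<2}" for k
    using s that by (auto simp: separating_def)
  from this[of 0] this[of 1]
  have "if v then btw (fst (p 0)) (fst (p 3)) (fst (p 2)) \<and> btw (fst (p 1)) (fst (p 3)) (fst (p 2))
      else btw (snd (p 0)) (snd (p 3)) (snd (p 2)) \<and> btw (snd (p 1)) (snd (p 3)) (snd (p 2))"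
    by (auto split: if_splits)
  then have side: "if v then (fst (p 0) < fst (p 2) \<longleftrightarrow> fst (p 1) < fst (p 2))
      else (snd (p 0) < snd (p 2) \<longleftrightarrow> snd (p 1) < snd (p 2))"
    by (auto simp: btw_def)
  note defs = above_def below_def left_of_def right_of_def first_letters_def quadrant_def
    numerals_def
  show ?thesis
  proof (cases "b \<in> directions")
    case False
    then show ?thesis
      using ib encodes_1[OF a] by (cases b) (auto simp: defs directions_def)
  next
    case True
    note sep = sb[OF True]
    show ?thesis
      using True encodes_1[OF a] ib sep side
      by (cases b; cases a) (auto simp: defs directions_def separates_def split: if_splits)
  qed
qed

text \<open>Only one axis is available to a pin that is not extremal in both coordinates, and p_1
  decides the side. The origin is left out of the sets, so the letter depends on the pins
  alone.\<close>

lemma direction_unique: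
  assumes "c \<in> directions" "c' \<in> directions" "1 < l"
    and "in_position c (p l) (p ` {1..<l})" "in_position c' (p l) (p ` {1..<l})"
    and "\<not> extremal 1 (\<lambda>i. fst (p i)) l \<or> \<not> extremal 1 (\<lambda>i. snd (p i)) l"
  shows "c = c'"
proof -
  have "1 \<in> {1..<l}" using assms(3) by auto
  then have "p 1 \<in> p ` {1..<l}" by blast
  have *: "(above (p l) (p ` {1..<l}) \<or> below (p l) (p ` {1..<l}) \<longrightarrow> extremal 1 (\<lambda>i. snd (p i)) l)"
    "(left_of (p l) (p ` {1..<l}) \<or> right_of (p l) (p ` {1..<l}) \<longrightarrow> extremal 1 (\<lambda>i. fst (p i)) l)"
    by (auto simp: above_def below_def left_of_def right_of_def extremal_def)
  have **: "\<not> (above (p l) (p ` {1..<l}) \<and> below (p l) (p ` {1..<l}))"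
    "\<not> (left_of (p l) (p ` {1..<l}) \<and> right_of (p l) (p ` {1..<l}))"
    using \<open>p 1 \<in> p ` {1..<l}\<close> unfolding above_def below_def left_of_def right_of_def
    by (meson less_asym)+
  show ?thesis
    using assms(1,2,4-6) * ** by (cases c; cases c') (simp_all add: directions_def; blast)+
qed

lemma in_position_realizes:
  assumes "realizes n \<pi> p g" "realizes n \<pi> p' g'" "\<forall>i\<in>{1..n}. g i = g' i"
    and "l \<in> {1..n}" "in_position c (p l) (p ` {1..<l})"
  shows "in_position c (p' l) (p' ` {1..<l})"
proof -
  have "(fst (p i) < fst (p j) \<longleftrightarrow> fst (p' i) < fst (p' j)) \<and> (snd (p i) < snd (p j) \<longleftrightarrow> snd (p' i) < snd (p' j))"
    if "i \<in> {1..n}" "j \<in> {1..n}" for i j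
    using assms(1-3) that by (simp add: realizes_def)
  moreover have "{1..<l} \<subseteq> {1..n}" using assms(4) by auto
  ultimately show ?thesis
    using assms(4,5) by (cases c) (simp_all add: above_def below_def left_of_def right_of_def subset_iff)
qed

definition pin_word_of :: "nat \<Rightarrow> (nat \<Rightarrow> nat) \<Rightarrow> pin_letter list \<Rightarrow> (nat \<Rightarrow> point) \<Rightarrow> (nat \<Rightarrow> nat) \<Rightarrow> bool" where
  "pin_word_of n \<pi> w p g \<longleftrightarrow> length w = n \<and> realizes n \<pi> p g \<and> pin_sequence 0 n p \<and>
     (\<forall>i<n. encodes p (Suc i) (w ! i))"

lemma pin_words_imp_pin_word_of: "w \<in> pin_words n \<pi> \<Longrightarrow> \<exists>p g. pin_word_of n \<pi> w p g"
  unfolding pin_words_def pin_word_of_def using pin_representation_realizes by blast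

context
  fixes n :: nat and \<pi> :: "nat \<Rightarrow> nat"
  assumes simple: "simple_permutation n \<pi>"
begin

lemma n4: "4 \<le> n"
  using simple by (simp add: simple_permutation_def)

lemma pin_word_direction:
  assumes w: "pin_word_of n \<pi> w p g" and i: "2 \<le> i" "i < n"
  shows "w ! i \<in> directions"
proof (rule ccontr)
  assume "w ! i \<notin> directions"
  then have "\<not> splits (p (Suc i)) (p ` {0..<Suc i})"
    using w i by (auto simp: pin_word_of_def encodes_def)
  then show False
    using simple_pin_splits[OF simple, of p g "Suc i"] w i by (simp add: pin_word_of_def)
qed

text \<open>The first two labels determine the pin order, and the relative positions of the pins
  determine all letters from the third on. The origin can influence only the first two.\<close>

lemma pin_word_unique:
  assumes w: "pin_word_of n \<pi> w p g" and w': "pin_word_of n \<pi> w' p' g'"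
    and eq: "g 1 = g' 1" "g 2 = g' 2" "w ! 0 = w' ! 0" "w ! 1 = w' ! 1"
  shows "w = w'"
proof (rule nth_equalityI)
  show "length w = length w'" using w w' by (simp add: pin_word_of_def)
  fix i assume "i < length w"
  then have i: "i < n" using w by (simp add: pin_word_of_def)
  have geq: "\<forall>i\<in>{1..n}. g i = g' i"
    using pin_order_unique[OF simple_pin_order simple_pin_order eq(1,2)] simple w w'
    by (auto simp: pin_word_of_def)
  show "w ! i = w' ! i"
  proof (cases "i < 2")
    case True
    then show ?thesis using eq(3,4) by (auto simp: less_2_cases_iff)
  next
    case False
    let ?l = "Suc i"
    have l: "?l \<in> {1..n}" "1 < ?l" "3 \<le> ?l" "?l \<le> n" "{1..<?l} \<subseteq> {0..<?l}" using i False by auto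
    have pos: "in_position (w ! i) (p ?l) (p ` {1..<?l})" "in_position (w' ! i) (p' ?l) (p' ` {1..<?l})"
      using in_position_mono[OF encodes_in_position image_mono[OF l(5)]] w w' i
      by (auto simp: pin_word_of_def)
    have r: "realizes n \<pi> p g" "realizes n \<pi> p' g'" using w w' by (auto simp: pin_word_of_def)
    have "\<not> extremal 1 (\<lambda>i. fst (p i)) ?l \<or> \<not> extremal 1 (\<lambda>i. snd (p i)) ?l"
      using simple_pin_step[OF simple r(1), of ?l] w l
        separating_not_extremal[of 1 "\<lambda>i. fst (p i)" ?l] separating_not_extremal[of 1 "\<lambda>i. snd (p i)" ?l]
        separating_mono[of 0 _ ?l 1] by (auto simp: pin_word_of_def)
    then show ?thesis
      using direction_unique[OF pin_word_direction[OF w] pin_word_direction[OF w'] l(2) pos(1)]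
        in_position_realizes[OF r(2,1) _ l(1) pos(2)] geq i False by auto
  qed
qed

text \<open>The orientation of p_3 is to be read off from the first two labels alone. As p_3 is the
  only point cutting \<open>{g 1, g 2}\<close>, it separates by a vertical line exactly if some
  column lies between theirs.\<close>

lemma pin_word_first_letters:
  assumes w: "pin_word_of n \<pi> w p g"
  shows "(w ! 0, w ! 1) \<in> first_letters (g 1 < g 2) (\<pi> (g 1) < \<pi> (g 2))
    (\<exists>m\<in>{1..n}. btw (real (g 1)) (real m) (real (g 2)))" (is "_ \<in> first_letters _ _ ?v")
proof -
  have r: "realizes n \<pi> p g" and p: "pin_sequence 0 n p" and e: "\<forall>i<n. encodes p (Suc i) (w ! i)"
    using w by (auto simp: pin_word_of_def)
  have bij: "bij_betw g {1..n} {1..n}" using r by (simp add: realizes_def)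
  have m: "(1::nat) \<in> {1..n}" "2 \<in> {1..n}" "3 \<in> {1..n}" using n4 by auto
  have ord: "fst (p i) < fst (p j) \<longleftrightarrow> g i < g j" if "i \<in> {1..n}" "j \<in> {1..n}" for i j
    using r that unfolding realizes_def by blast
  have ord2: "snd (p i) < snd (p j) \<longleftrightarrow> \<pi> (g i) < \<pi> (g j)" if "i \<in> {1..n}" "j \<in> {1..n}" for i j
    using r that unfolding realizes_def by blast
  have o: "pin_order n real (\<lambda>v. real (\<pi> v)) g" by (rule simple_pin_order[OF simple r p])
  have only: "m = g 3" if "m \<in> {1..n}" "btw (real (g 1)) (real m) (real (g 2))" for m
  proof -
    have "{1..2::nat} = {1, 2}" by auto
    moreover have "m \<notin> {g 1, g 2}" using that(2) by (auto simp: btw_def)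
    ultimately have "cuts real (\<lambda>v. real (\<pi> v)) (g ` {1..2}) m"
      using that(2) by (intro cutsI1[of "g 1" _ "g 2"]) auto
    then show ?thesis using pin_order_cuts_iff[OF o, of 2 m] that(1) n4 by auto
  qed
  have g3: "g 3 \<in> {1..n}" using bij m(3) by (auto simp: bij_betw_def)
  have btw3: "btw (fst (p 1)) (fst (p 3)) (fst (p 2)) \<longleftrightarrow> ?v"
  proof
    assume "btw (fst (p 1)) (fst (p 3)) (fst (p 2))"
    then have "btw (real (g 1)) (real (g 3)) (real (g 2))" using ord m by (auto simp: btw_def)
    then show ?v using g3 by blast
  next
    assume ?v
    then have "btw (real (g 1)) (real (g 3)) (real (g 2))" using only by blast
    then show "btw (fst (p 1)) (fst (p 3)) (fst (p 2))" using ord m by (auto simp: btw_def)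
  qed
  have st: "separating 0 (\<lambda>i. fst (p i)) 3 \<and> extremal 0 (\<lambda>i. snd (p i)) 3 \<or>
      separating 0 (\<lambda>i. snd (p i)) 3 \<and> extremal 0 (\<lambda>i. fst (p i)) 3"
    using simple_pin_step[OF simple r p, of 3] n4 by auto
  have "separating 0 (\<lambda>i. if ?v then fst (p i) else snd (p i)) 3"
  proof (cases ?v)
    case True
    then have "\<not> extremal 0 (\<lambda>i. fst (p i)) 3"
      using btw3 extremal_not_btw[of 0 "\<lambda>i. fst (p i)" 3 1 2] by auto
    then show ?thesis using st True by simp
  next
    case False
    then have "\<not> separating 0 (\<lambda>i. fst (p i)) 3"
      using btw3 by (auto simp: separating_def)
    then show ?thesis using st False by (simp only: if_False) blast
  qed
  from encodes_first_letters[OF _ _ this, of "w ! 0" "w ! 1"] e n4 ord[OF m(1,2)] ord2[OF m(1,2)]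
  show ?thesis by simp
qed

lemma pin_word_strict_or_quasi_strict:
  assumes w: "pin_word_of n \<pi> w p g"
  shows "strict_pin_word w \<or> quasi_strict_pin_word w"
proof -
  have len: "length w = n" using w by (simp add: pin_word_of_def)
  then obtain a b v where abv: "w = a # b # v"
    using n4 by (cases w; cases "tl w") auto
  have "encodes p (Suc 0) a" using w abv len by (auto simp: pin_word_of_def)
  then have a: "a \<in> numerals" by (rule encodes_1)
  have "v ! i \<in> directions" if "i < length v" for i
    using pin_word_direction[OF w, of "Suc (Suc i)"] that len abv by simp
  then have v: "set v \<subseteq> directions" by (auto simp: in_set_conv_nth)
  have "b \<in> numerals \<or> b \<in> directions" by (cases b) (auto simp: numerals_def directions_def)
  then show ?thesis using a v abv by (auto simp: strict_pin_word_def quasi_strict_pin_word_def)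
qed

text \<open>Each word is sent to its first two labels, for one chosen pin sequence, and its first
  two letters. This is injective by \<open>pin_word_unique\<close>, and there are at most 8 starts
  with at most 6 pairs of letters each.\<close>

lemma card_pin_words: "finite (pin_words n \<pi>)" "card (pin_words n \<pi>) \<le> 48"
proof -
  define P where "P = {(r 1, r 2) | r. pin_order n real (\<lambda>v. real (\<pi> v)) r}"
  define E where "E = (\<lambda>(u, v). first_letters (u < v) (\<pi> u < \<pi> v) (\<exists>m\<in>{1..n}. btw (real u) (real m) (real v)))"
  have P: "finite P" "card P \<le> 8" using card_pin_order_starts[OF n4] by (auto simp: P_def)
  have E: "finite (E q)" "card (E q) \<le> 6" for q
    using card_first_letters by (auto simp: E_def split: prod.split)
  have "\<forall>w\<in>pin_words n \<pi>. \<exists>g p. pin_word_of n \<pi> w p g"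
    using pin_words_imp_pin_word_of by blast
  from bchoice[OF this] obtain g where "\<forall>w\<in>pin_words n \<pi>. \<exists>p. pin_word_of n \<pi> w p (g w)" by blast
  from bchoice[OF this] obtain p where pg: "\<And>w. w \<in> pin_words n \<pi> \<Longrightarrow> pin_word_of n \<pi> w (p w) (g w)" by blast
  define h where "h = (\<lambda>w. ((g w 1, g w 2), (w ! 0 :: pin_letter, w ! 1)))"
  have inj: "inj_on h (pin_words n \<pi>)"
    by (rule inj_onI) (auto simp: h_def dest: pin_word_unique[OF pg pg])
  have sub: "h ` pin_words n \<pi> \<subseteq> Sigma P E"
  proof
    fix z assume "z \<in> h ` pin_words n \<pi>"
    then obtain w where w: "w \<in> pin_words n \<pi>" "z = h w" by blast
    have "pin_order n real (\<lambda>v. real (\<pi> v)) (g w)"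
      using simple_pin_order[OF simple] pg[OF w(1)] by (auto simp: pin_word_of_def)
    then have "(g w 1, g w 2) \<in> P" by (auto simp: P_def)
    moreover have "(w ! 0, w ! 1) \<in> E (g w 1, g w 2)"
      using pin_word_first_letters[OF pg[OF w(1)]] by (simp add: E_def)
    ultimately show "z \<in> Sigma P E" using w(2) by (simp add: h_def)
  qed
  have fin: "finite (Sigma P E)" using P(1) E(1) by simp
  show "finite (pin_words n \<pi>)"
    using finite_imageD[OF finite_subset[OF sub fin] inj] .
  have "card (pin_words n \<pi>) = card (h ` pin_words n \<pi>)" by (simp add: card_image[OF inj])
  also have "\<dots> \<le> card (Sigma P E)" by (rule card_mono[OF fin sub])
  also have "\<dots> = (\<Sum>q\<in>P. card (E q))" using P(1) E(1) by (simp add: card_SigmaI)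
  also have "\<dots> \<le> card P * 6" using sum_bounded_above[of P "\<lambda>q. card (E q)" 6] E(2) by simp
  also have "\<dots> \<le> 48" using P(2) by simp
  finally show "card (pin_words n \<pi>) \<le> 48" .
qed

end

theorem theoremB8:
  fixes n :: nat and \<pi> :: "nat \<Rightarrow> nat"
  assumes "simple_permutation n \<pi>"
  shows "finite (pin_words n \<pi>) \<and> card (pin_words n \<pi>) \<le> 48 \<and>
         (\<forall>w\<in>pin_words n \<pi>. strict_pin_word w \<or> quasi_strict_pin_word w)"
  using card_pin_words[OF assms] pin_word_strict_or_quasi_strict[OF assms]
    pin_words_imp_pin_word_of by blast

end
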